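(* The diagram $\mathbf{E}_8^{(1)}$ has exactly $3$ orbits of labelings: 1. the orbit of zero, consisting of all the labelings with an odd number of components (including the component of the boxed 1); 2. the fixed labeling $\ell'_3$ with $a_2=a_4=a_8=1$ and all other $a_i=0$; 3. the orbit consisting of the labelings with an even number of components (including the component of the boxed 1), excluding the fixed labeling $\ell'_3$, with representative the labeling with $a_2=a_4=a_6=1$ and all other $a_i=0$.
   Context: $\mathbf{E}_8^{(1)}$ is the Dynkin diagram $\mathbf{E}_8$ with vertices $1,\dots,8$, edges $\{1,2\},\{2,3\},\{3,4\},\{4,5\},\{5,6\},\{6,7\},\{5,8\}$, with vertex $1$ colored black. A labeling is $\boldsymbol a=(a_1,\dots,a_8)\in(\mathbb{Z}/2\mathbb{Z})^8$. The augmented diagram is obtained by adding one extra vertex (the "boxed 1"), joined by an edge to vertex $1$ only, carrying the constant label $1$. For $1\le i\le 8$ the move $\mathcal{M}_i$ changes only $a_i$, replacing it by $a_i$ plus the sum (in $\mathbb{Z}/2\mathbb{Z}$) of the labels of all neighbors of $i$ in the augmented diagram (including the boxed 1 when $i=1$). There is no move at the boxed vertex. Orbits are the equivalence classes of labelings under finite sequences of moves; a fixed labeling is one fixed by all moves (so it forms an orbit by itself). Components of a labeling are the connected components of the subgraph of the augmented diagram induced on the vertices with label $1$, the boxed vertex included. *)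

theory Defs
  imports Main "HOL-Library.FuncSet" "HOL-Library.Z2"
begin

definition e8_vertices :: "nat set" where
  "e8_vertices = {1..8}"

definition e8_edges :: "nat set set" where
  "e8_edges = {{1,2}, {2,3}, {3,4}, {4,5}, {5,6}, {6,7}, {5,8}}"

text \<open>The vertex \<open>0\<close> plays the role of the boxed 1.  It is attached to the black vertices of the
  diagram, here only to vertex \<open>1\<close>.\<close>

definition aug_vertices :: "nat set" where
  "aug_vertices = insert 0 e8_vertices"

definition aug_edges :: "nat set set" where
  "aug_edges = insert {0,1} e8_edges"

definition neighbors :: "nat \<Rightarrow> nat set" where
  "neighbors i = {j \<in> aug_vertices. {i,j} \<in> aug_edges}"

text \<open>Labelings are extensional functions (\<open>undefined\<close> outside \<open>{1..8}\<close>), so that they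
  correspond bijectively to the elements of $(\mathbb{Z}/2\mathbb{Z})^8$.\<close>

definition labelings :: "(nat \<Rightarrow> bit) set" where
  "labelings = e8_vertices \<rightarrow>\<^sub>E UNIV"

definition aug_label :: "(nat \<Rightarrow> bit) \<Rightarrow> nat \<Rightarrow> bit" where
  "aug_label a = a(0 := 1)"

definition move :: "nat \<Rightarrow> (nat \<Rightarrow> bit) \<Rightarrow> (nat \<Rightarrow> bit)" where
  "move i a = a(i := a i + (\<Sum>j\<in>neighbors i. aug_label a j))"

definition orbit_rel :: "((nat \<Rightarrow> bit) \<times> (nat \<Rightarrow> bit)) set" where
  "orbit_rel = {(a, b). a \<in> labelings \<and> (\<exists>is \<in> lists e8_vertices. b = fold move is a)}"

definition orbits :: "(nat \<Rightarrow> bit) set set" where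
  "orbits = labelings // orbit_rel"

definition orbit :: "(nat \<Rightarrow> bit) \<Rightarrow> (nat \<Rightarrow> bit) set" where
  "orbit a = orbit_rel `` {a}"

definition fixed_labeling :: "(nat \<Rightarrow> bit) \<Rightarrow> bool" where
  "fixed_labeling a \<longleftrightarrow> a \<in> labelings \<and> (\<forall>i\<in>e8_vertices. move i a = a)"

definition support :: "(nat \<Rightarrow> bit) \<Rightarrow> nat set" where
  "support a = {v \<in> aug_vertices. aug_label a v = 1}"

definition induced_adj :: "nat set \<Rightarrow> (nat \<times> nat) set" where
  "induced_adj S = {(u, v). u \<in> S \<and> v \<in> S \<and> {u, v} \<in> aug_edges}"

definition components :: "(nat \<Rightarrow> bit) \<Rightarrow> nat set set" where
  "components a = support a // (induced_adj (support a))\<^sup>*"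

definition num_components :: "(nat \<Rightarrow> bit) \<Rightarrow> nat" where
  "num_components a = card (components a)"

definition labeling_of :: "nat set \<Rightarrow> nat \<Rightarrow> bit" where
  "labeling_of S = (\<lambda>i\<in>e8_vertices. if i \<in> S then 1 else 0)"

lemma move_in_labelings: "a \<in> labelings \<Longrightarrow> i \<in> e8_vertices \<Longrightarrow> move i a \<in> labelings"
  by (auto simp: labelings_def move_def PiE_iff extensional_def)

lemma move_move: "i \<in> e8_vertices \<Longrightarrow> move i (move i a) = a"
proof -
  assume "i \<in> e8_vertices"
  then have i: "i \<noteq> 0" by (auto simp: e8_vertices_def)
  have "i \<notin> neighbors i"
    by (auto simp: neighbors_def aug_edges_def e8_edges_def doubleton_eq_iff)
  then have "(\<Sum>j\<in>neighbors i. aug_label (move i a) j) = (\<Sum>j\<in>neighbors i. aug_label a j)"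
    by (intro sum.cong) (auto simp: aug_label_def move_def)
  moreover have "move i a i = a i + (\<Sum>j\<in>neighbors i. aug_label a j)"
    by (simp add: move_def)
  moreover have "x + y + y = x" for x y :: bit
    by (cases y) simp_all
  ultimately have "move i (move i a) = (move i a)(i := a i)"
    unfolding move_def[of i "move i a"] by metis
  then show ?thesis by (simp add: move_def)
qed

lemma equiv_orbit_rel: "equiv labelings orbit_rel"
proof (rule equivI)
  have closed: "fold move is a \<in> labelings" if "is \<in> lists e8_vertices" "a \<in> labelings" for "is" a
    using that by (induction "is" arbitrary: a) (auto intro: move_in_labelings)
  have inv: "fold move (rev is) (fold move is a) = a" if "is \<in> lists e8_vertices" for "is" a
    using that by (induction "is" arbitrary: a) (auto simp: move_move)
  show "orbit_rel \<subseteq> labelings \<times> labelings"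
    using closed by (auto simp: orbit_rel_def)
  show "refl_on labelings orbit_rel"
    by (auto simp: refl_on_def orbit_rel_def intro!: bexI[of _ "[]"])
  show "sym orbit_rel"
  proof (rule symI)
    fix a b assume "(a, b) \<in> orbit_rel"
    then obtain "is" where ab: "a \<in> labelings" "is \<in> lists e8_vertices" "b = fold move is a"
      by (auto simp: orbit_rel_def)
    then have "b \<in> labelings" "a = fold move (rev is) b" "rev is \<in> lists e8_vertices"
      using closed inv by auto
    then show "(b, a) \<in> orbit_rel" unfolding orbit_rel_def by blast
  qed
  show "trans orbit_rel"
  proof (rule transI)
    fix a b c assume "(a, b) \<in> orbit_rel" "(b, c) \<in> orbit_rel"
    then obtain "is" js where "a \<in> labelings" "is \<in> lists e8_vertices" "js \<in> lists e8_vertices"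
      "c = fold move (is @ js) a"
      by (auto simp: orbit_rel_def)
    then show "(a, c) \<in> orbit_rel" unfolding orbit_rel_def
      by (auto intro!: bexI[of _ "is @ js"])
  qed
qed

end

theory Submission
  imports Defs
begin

text \<open>
  The augmented diagram is a tree, so every component of a labeling has a unique vertex closest to
  the boxed \<open>1\<close>.  Counting these vertices expresses the number of components modulo \<open>2\<close> as a
  quadratic polynomial in the labels, which all moves preserve.  Conversely, weight vertex \<open>i\<close> by
  \<open>2\<^sup>i\<close>.  Short sequences of moves decrease the weight of every labeling except the fixed one and
  those with support \<open>{}\<close>, \<open>{2}\<close>, \<open>{2, 4}\<close>, \<open>{2, 4, 6}\<close>, which are the normal forms on the path
  \<open>1, \<dots>, 7\<close> by number of components.  Two explicit longer sequences identify \<open>{2}\<close> with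
  \<open>{2, 4, 6}\<close> and \<open>{2, 4}\<close> with \<open>{}\<close>, so every labeling reaches one of the three representatives.
\<close>

section \<open>Components of a rooted forest, counted by roots\<close>

text \<open>Read \<open>D\<close> as the edges from vertices to their parents. Walking along
  \<open>D\<close> is deterministic and terminates, so each class of the generated equivalence
  contains exactly one vertex without a parent.\<close>

lemma card_quotient_single_valued:
  assumes "single_valued D" and wf: "wf (D\<inverse>)" and D: "D \<subseteq> S \<times> S"
  shows "card (S // (D \<union> D\<inverse>)\<^sup>*) = card (S - Domain D)"
proof -
  let ?R = "(D \<union> D\<inverse>)\<^sup>*"
  have sym: "sym ?R"
    by (intro sym_rtrancl) (auto simp: sym_def)
  have root: "\<exists>x \<in> S - Domain D. (v, x) \<in> ?R" if "v \<in> S" for v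
    using wf that
  proof (induction v)
    case (less v)
    show ?case
    proof (cases "v \<in> Domain D")
      case True
      then obtain w where "(v, w) \<in> D" by blast
      with less D obtain x where "x \<in> S - Domain D" "(w, x) \<in> ?R" by blast
      with \<open>(v, w) \<in> D\<close> show ?thesis
        by (meson UnI1 converse_rtrancl_into_rtrancl)
    qed (use less in blast)
  qed
  \<comment> \<open>A walk from a root stays among its descendants: a step from \<open>v\<close> to
    its parent follows the only \<open>D\<close>-path from \<open>v\<close> to
    \<open>x\<close>.\<close>
  have desc: "(v, x) \<in> D\<^sup>*" if "(x, v) \<in> ?R" "x \<notin> Domain D" for x v
    using that
  proof (induction rule: rtrancl_induct)
    case (step v w)
    show ?case
    proof (cases "(w, v) \<in> D")
      case False
      with step have "(v, w) \<in> D" "v \<noteq> x" "(v, x) \<in> D\<^sup>*" by auto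
      then show ?thesis
        using \<open>single_valued D\<close> by (metis converse_rtranclE single_valuedD)
    qed (use step in \<open>auto intro: converse_rtrancl_into_rtrancl\<close>)
  qed auto
  have inj: "inj_on (\<lambda>x. ?R `` {x}) (S - Domain D)"
  proof (rule inj_onI)
    fix x y assume xy: "x \<in> S - Domain D" "y \<in> S - Domain D" "?R `` {x} = ?R `` {y}"
    then have "(x, y) \<in> ?R" by auto
    with xy desc have "(y, x) \<in> D\<^sup>*" by blast
    with xy show "x = y" by (metis DiffD2 Domain.DomainI converse_rtranclE)
  qed
  have "?R `` {v} = ?R `` {x}" if "(v, x) \<in> ?R" for v x
    using that sym by (auto dest: symD intro: rtrancl_trans)
  with root have "(\<lambda>x. ?R `` {x}) ` (S - Domain D) = S // ?R"
    unfolding quotient_def by (fastforce simp: image_iff)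
  with inj show ?thesis by (metis card_image)
qed

text \<open>Roots the diagram at the boxed vertex 0. Truncated subtraction gives
  \<open>parent 0 = 0\<close>, hence the separate treatment of 0 below.\<close>

definition parent :: "nat \<Rightarrow> nat" where
  "parent v = (if v = 8 then 5 else v - 1)"

definition parent_rel :: "nat set \<Rightarrow> (nat \<times> nat) set" where
  "parent_rel S = {(v, w). v \<in> S \<and> w \<in> S \<and> v \<noteq> 0 \<and> w = parent v}"

lemma aug_vertices_eq: "aug_vertices = {..8}"
  by (auto simp: aug_vertices_def e8_vertices_def)

lemma aug_edges_iff:
  "{u, v} \<in> aug_edges \<longleftrightarrow>
    u \<le> 8 \<and> v \<le> 8 \<and> (u \<noteq> 0 \<and> v = parent u \<or> v \<noteq> 0 \<and> u = parent v)"
  unfolding aug_edges_def e8_edges_def parent_def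
  by (simp add: doubleton_eq_iff) presburger

text \<open>Each edge joins a vertex to its parent, so adjacency in the support is the symmetric
  closure of \<open>parent_rel\<close>, and components are counted by their top vertices.\<close>

lemma card_components:
  "num_components a = card {v \<in> support a. v = 0 \<or> parent v \<notin> support a}"
proof -
  let ?S = "support a" and ?D = "parent_rel (support a)"
  have "?D\<inverse> \<subseteq> less_than"
    by (auto simp: parent_rel_def parent_def)
  then have wf: "wf (?D\<inverse>)"
    using wf_less_than wf_subset by blast
  have "\<And>v. v \<in> ?S \<Longrightarrow> v \<le> 8"
    by (auto simp: support_def aug_vertices_eq)
  then have "induced_adj ?S = ?D \<union> ?D\<inverse>"
    unfolding induced_adj_def aug_edges_iff parent_rel_def by blast
  moreover have "?S - Domain ?D = {v \<in> ?S. v = 0 \<or> parent v \<notin> ?S}"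
    by (auto simp: parent_rel_def)
  ultimately show ?thesis
    using card_quotient_single_valued[OF _ wf, of ?S]
    by (auto simp: num_components_def components_def parent_rel_def single_valued_def)
qed

section \<open>Labelings in coordinates\<close>

text \<open>An explicit 8-tuple lets the simplifier evaluate moves and check statements over all 256
  labelings by cases.\<close>

definition lab :: "bit \<Rightarrow> bit \<Rightarrow> bit \<Rightarrow> bit \<Rightarrow> bit \<Rightarrow> bit \<Rightarrow> bit \<Rightarrow> bit \<Rightarrow> nat \<Rightarrow> bit" where
  "lab b1 b2 b3 b4 b5 b6 b7 b8 =
    (\<lambda>i\<in>e8_vertices. [b1, b2, b3, b4, b5, b6, b7, b8] ! (i - 1))"

lemma e8_vertices_eq: "e8_vertices = {1, 2, 3, 4, 5, 6, 7, 8}"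
  by (auto simp: e8_vertices_def)

lemma sum_e8_vertices:
  fixes f :: "nat \<Rightarrow> 'a::comm_monoid_add"
  shows "(\<Sum>i\<in>e8_vertices. f i) = f 1 + (f 2 + (f 3 + (f 4 + (f 5 + (f 6 + (f 7 + f 8))))))"
  by (simp add: e8_vertices_eq)

lemma lab_apply [simp]:
  "lab b1 b2 b3 b4 b5 b6 b7 b8 (Suc 0) = b1"
  "lab b1 b2 b3 b4 b5 b6 b7 b8 2 = b2"
  "lab b1 b2 b3 b4 b5 b6 b7 b8 3 = b3"
  "lab b1 b2 b3 b4 b5 b6 b7 b8 4 = b4"
  "lab b1 b2 b3 b4 b5 b6 b7 b8 5 = b5"
  "lab b1 b2 b3 b4 b5 b6 b7 b8 6 = b6"
  "lab b1 b2 b3 b4 b5 b6 b7 b8 7 = b7"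
  "lab b1 b2 b3 b4 b5 b6 b7 b8 8 = b8"
  by (simp_all add: lab_def e8_vertices_def)

lemma lab_in_labelings [simp]: "lab b1 b2 b3 b4 b5 b6 b7 b8 \<in> labelings"
  by (auto simp: labelings_def lab_def)

lemma labelings_eqI:
  assumes "a \<in> labelings" "b \<in> labelings" "\<And>i. i \<in> e8_vertices \<Longrightarrow> a i = b i"
  shows "a = b"
  using assms unfolding labelings_def by (meson PiE_ext)

lemma labelings_cases:
  assumes "a \<in> labelings"
  obtains b1 b2 b3 b4 b5 b6 b7 b8 where "a = lab b1 b2 b3 b4 b5 b6 b7 b8"
proof
  show "a = lab (a 1) (a 2) (a 3) (a 4) (a 5) (a 6) (a 7) (a 8)"
    using assms by (rule labelings_eqI) (auto simp: e8_vertices_eq)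
qed

lemma lab_inject [simp]:
  "lab b1 b2 b3 b4 b5 b6 b7 b8 = lab c1 c2 c3 c4 c5 c6 c7 c8 \<longleftrightarrow>
    b1 = c1 \<and> b2 = c2 \<and> b3 = c3 \<and> b4 = c4 \<and> b5 = c5 \<and> b6 = c6 \<and> b7 = c7 \<and> b8 = c8"
  by (metis lab_apply)

lemma labeling_of_eq_lab:
  "labeling_of {} = lab 0 0 0 0 0 0 0 0"
  "labeling_of {2, 4, 6} = lab 0 1 0 1 0 1 0 0"
  "labeling_of {2, 4, 8} = lab 0 1 0 1 0 0 0 1"
  by (rule labelings_eqI; auto simp: labeling_of_def labelings_def lab_def e8_vertices_eq)+

lemma neighbors_eq:
  "neighbors (Suc 0) = {0, 2}" "neighbors 2 = {1, 3}" "neighbors 3 = {2, 4}" "neighbors 4 = {3, 5}"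
  "neighbors 5 = {4, 6, 8}" "neighbors 6 = {5, 7}" "neighbors 7 = {6}" "neighbors 8 = {5}"
  unfolding neighbors_def aug_edges_iff aug_vertices_eq parent_def by auto

lemma move_lab [simp]:
  "move (Suc 0) (lab b1 b2 b3 b4 b5 b6 b7 b8) = lab (b1 + (1 + b2)) b2 b3 b4 b5 b6 b7 b8"
  "move 2 (lab b1 b2 b3 b4 b5 b6 b7 b8) = lab b1 (b2 + (b1 + b3)) b3 b4 b5 b6 b7 b8"
  "move 3 (lab b1 b2 b3 b4 b5 b6 b7 b8) = lab b1 b2 (b3 + (b2 + b4)) b4 b5 b6 b7 b8"
  "move 4 (lab b1 b2 b3 b4 b5 b6 b7 b8) = lab b1 b2 b3 (b4 + (b3 + b5)) b5 b6 b7 b8"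
  "move 5 (lab b1 b2 b3 b4 b5 b6 b7 b8) = lab b1 b2 b3 b4 (b5 + (b4 + (b6 + b8))) b6 b7 b8"
  "move 6 (lab b1 b2 b3 b4 b5 b6 b7 b8) = lab b1 b2 b3 b4 b5 (b6 + (b5 + b7)) b7 b8"
  "move 7 (lab b1 b2 b3 b4 b5 b6 b7 b8) = lab b1 b2 b3 b4 b5 b6 (b7 + b6) b8"
  "move 8 (lab b1 b2 b3 b4 b5 b6 b7 b8) = lab b1 b2 b3 b4 b5 b6 b7 (b8 + b5)"
  by (rule labelings_eqI[OF move_in_labelings];
      auto simp: e8_vertices_eq move_def neighbors_eq aug_label_def)+

section \<open>The number of components modulo 2 as an invariant\<close>

text \<open>A summand is 1 exactly when \<open>v\<close> is the top of a component: labeled 1, with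
  parent labeled 0. The leading 1 counts the component of the boxed vertex.\<close>

definition parity :: "(nat \<Rightarrow> bit) \<Rightarrow> bit" where
  "parity a = 1 + (\<Sum>v\<in>e8_vertices. a v * (1 + aug_label a (parent v)))"

lemma of_nat_num_components: "of_nat (num_components a) = parity a"
proof -
  let ?f = "\<lambda>v. of_bool (v \<in> support a \<and> (v = 0 \<or> parent v \<notin> support a)) :: bit"
  have "{v \<in> support a. v = 0 \<or> parent v \<notin> support a} =
      {v \<in> {..8}. v \<in> support a \<and> (v = 0 \<or> parent v \<notin> support a)}"
    by (auto simp: support_def aug_vertices_eq)
  then have "of_nat (num_components a) = (\<Sum>v\<in>{..8}. ?f v)"
    unfolding card_components
    by (subst sum_of_bool_eq) (auto intro!: arg_cong[where f = of_nat] arg_cong[where f = card])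
  also have "\<dots> = ?f 0 + (\<Sum>v\<in>e8_vertices. ?f v)"
    unfolding aug_vertices_eq[symmetric] aug_vertices_def
    by (rule sum.insert) (auto simp: e8_vertices_def)
  also have "(\<Sum>v\<in>e8_vertices. ?f v) = (\<Sum>v\<in>e8_vertices. a v * (1 + aug_label a (parent v)))"
    by (intro sum.cong) (auto simp: support_def aug_vertices_eq e8_vertices_def aug_label_def
      parent_def of_bool_def)
  finally show ?thesis
    by (simp add: parity_def support_def aug_vertices_def aug_label_def)
qed

lemma odd_num_components_iff: "odd (num_components a) \<longleftrightarrow> parity a = 1"
  unfolding of_nat_num_components[symmetric]
  by (metis even_of_nat_iff dvd_0_right odd_one bit_not_zero_iff)

text \<open>The summand of vertex 1 vanishes because its parent is the boxed 1.\<close>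

lemma parity_lab [simp]:
  "parity (lab b1 b2 b3 b4 b5 b6 b7 b8) = 1 + (b2 * (1 + b1) + (b3 * (1 + b2) +
    (b4 * (1 + b3) + (b5 * (1 + b4) + (b6 * (1 + b5) + (b7 * (1 + b6) + b8 * (1 + b5)))))))"
  unfolding parity_def sum_e8_vertices by (simp add: parent_def aug_label_def)

text \<open>The coefficient of \<open>a i\<close> in \<open>parity\<close> is \<open>1 + s\<close>,
  where \<open>s\<close> is the sum of the neighboring labels. The move adds \<open>s\<close> to
  \<open>a i\<close>, so \<open>parity\<close> changes by \<open>s * (1 + s) = 0\<close>. The proof
  checks this case by case.\<close>

lemma parity_move:
  assumes "a \<in> labelings" "i \<in> e8_vertices"
  shows "parity (move i a) = parity a"
proof -
  from assms(1) obtain b1 b2 b3 b4 b5 b6 b7 b8 where a: "a = lab b1 b2 b3 b4 b5 b6 b7 b8"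
    by (rule labelings_cases)
  have "\<forall>i\<in>e8_vertices. parity (move i a) = parity a"
    unfolding a e8_vertices_eq
    by (cases b1; cases b2; cases b3; cases b4; cases b5; cases b6; cases b7; cases b8) simp_all
  with assms(2) show ?thesis by blast
qed

section \<open>Descent to normal forms\<close>

text \<open>As with binary numbers, the highest vertex where two labelings differ decides which is
  lighter, so a descending word may set lower labels as long as it clears that one.\<close>

definition weight :: "(nat \<Rightarrow> bit) \<Rightarrow> nat" where
  "weight a = (\<Sum>i\<in>e8_vertices. of_bool (a i = 1) * 2 ^ i)"

lemma weight_lab [simp]:
  "weight (lab b1 b2 b3 b4 b5 b6 b7 b8) =
    of_bool (b1 = 1) * 2 + (of_bool (b2 = 1) * 4 + (of_bool (b3 = 1) * 8 +
    (of_bool (b4 = 1) * 16 + (of_bool (b5 = 1) * 32 + (of_bool (b6 = 1) * 64 +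
    (of_bool (b7 = 1) * 128 + of_bool (b8 = 1) * 256))))))"
  unfolding weight_def sum_e8_vertices by simp

lemma weight_descent:
  assumes "a \<in> labelings"
  shows "a \<in> {lab 0 0 0 0 0 0 0 0, lab 0 1 0 0 0 0 0 0, lab 0 1 0 1 0 0 0 0,
      lab 0 1 0 1 0 1 0 0, lab 0 1 0 1 0 0 0 1} \<or>
    (\<exists>is \<in> lists e8_vertices. weight (fold move is a) < weight a)"
    (is "?N \<or> _")
proof -
  \<comment> \<open>A single move descends exactly when it clears a label. The four longer words
    treat the labelings outside \<open>?N\<close> in which no single move does so.\<close>
  let ?words = "{[1], [2], [3], [4], [5], [6], [7], [8],
    [2,3,4], [4,5,6,7], [6,7,6,5,8], [2,3,4,5,8]} :: nat list set"
  from assms obtain b1 b2 b3 b4 b5 b6 b7 b8 where a: "a = lab b1 b2 b3 b4 b5 b6 b7 b8"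
    by (rule labelings_cases)
  have "?N \<or> (\<exists>is \<in> ?words. weight (fold move is a) < weight a)"
    unfolding a
    by (cases b1; cases b2; cases b3; cases b4; cases b5; cases b6; cases b7; cases b8) simp_all
  moreover have "?words \<subseteq> lists e8_vertices"
    by (simp add: e8_vertices_eq)
  ultimately show ?thesis by blast
qed

section \<open>Orbits and their representatives\<close>

lemma orbit_rel_fold:
  "a \<in> labelings \<Longrightarrow> is \<in> lists e8_vertices \<Longrightarrow> (a, fold move is a) \<in> orbit_rel"
  by (auto simp: orbit_rel_def)

lemma orbit_rel_trans: "(a, b) \<in> orbit_rel \<Longrightarrow> (b, c) \<in> orbit_rel \<Longrightarrow> (a, c) \<in> orbit_rel"
  using equiv_orbit_rel by (meson equivE transD)

lemma orbit_rel_in_labelings: "(a, b) \<in> orbit_rel \<Longrightarrow> b \<in> labelings"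
  using equiv_orbit_rel equiv_type by fastforce

lemma orbit_eq: "(a, b) \<in> orbit_rel \<Longrightarrow> orbit a = orbit b"
  unfolding orbit_def by (rule equiv_class_eq[OF equiv_orbit_rel])

lemma mem_orbit_self: "a \<in> labelings \<Longrightarrow> a \<in> orbit a"
  unfolding orbit_def by (rule equiv_class_self[OF equiv_orbit_rel])

lemma parity_orbit_rel:
  assumes "(a, b) \<in> orbit_rel"
  shows "parity b = parity a"
proof -
  from assms obtain "is" where "is \<in> lists e8_vertices" "a \<in> labelings" "b = fold move is a"
    by (auto simp: orbit_rel_def)
  then show ?thesis
    by (induction "is" arbitrary: a) (auto simp: parity_move move_in_labelings)
qed

lemma orbit_fixed_labeling:
  assumes "fixed_labeling a"
  shows "orbit a = {a}"
proof -
  have "fold move is a = a" if "is \<in> lists e8_vertices" for "is"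
    using that assms by (induction "is") (auto simp: fixed_labeling_def)
  then show ?thesis
    using assms by (auto simp: orbit_def orbit_rel_def fixed_labeling_def intro!: bexI[of _ "[]"])
qed

lemma orbit_rel_normal_form:
  assumes "a \<in> labelings"
  shows "\<exists>b \<in> {lab 0 0 0 0 0 0 0 0, lab 0 1 0 1 0 1 0 0, lab 0 1 0 1 0 0 0 1}. (a, b) \<in> orbit_rel"
  using assms
proof (induction "weight a" arbitrary: a rule: less_induct)
  case less
  have refl: "(a, a) \<in> orbit_rel"
    using orbit_rel_fold[OF less.prems, of "[]"] by simp
  \<comment> \<open>A move with exactly one neighbor labeled 1 adds or removes a leaf of a
    component. The number of components changes only at the branch vertex 5 with all three neighbors
    labeled 1, where three components merge or one splits. Both words below must use this, as they
    go from 2 to 4 and from 3 to 1 components.\<close>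
  have "(lab 0 1 0 0 0 0 0 0, lab 0 1 0 1 0 1 0 0) \<in> orbit_rel"
    using orbit_rel_fold[of "lab 0 1 0 0 0 0 0 0" "[3,4,5,6,7,8,5,4,3,6,5,4,8,5,6,7]"]
    by (simp add: e8_vertices_eq)
  moreover have "(lab 0 1 0 1 0 0 0 0, lab 0 0 0 0 0 0 0 0) \<in> orbit_rel"
    using orbit_rel_fold[of "lab 0 1 0 1 0 0 0 0"
      "[5,4,3,2,1,6,5,4,3,2,7,6,5,4,3,8,5,4,6,5,7,6,8,5,4,3,2,1]"]
    by (simp add: e8_vertices_eq)
  moreover have ?case if "is \<in> lists e8_vertices" "weight (fold move is a) < weight a" for "is"
    using less.hyps[OF that(2)] orbit_rel_fold[OF less.prems that(1)]
    by (meson orbit_rel_in_labelings orbit_rel_trans)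
  ultimately show ?case
    using weight_descent[OF less.prems] refl by blast
qed

theorem proposition13p3:
  shows "card orbits = 3 \<and>
    orbits = {orbit (labeling_of {}), {labeling_of {2, 4, 8}}, orbit (labeling_of {2, 4, 6})} \<and>
    orbit (labeling_of {}) = {a \<in> labelings. odd (num_components a)} \<and>
    fixed_labeling (labeling_of {2, 4, 8}) \<and>
    orbit (labeling_of {2, 4, 6}) =
      {a \<in> labelings. even (num_components a)} - {labeling_of {2, 4, 8}}"
proof -
  let ?z = "lab 0 0 0 0 0 0 0 0" and ?f = "lab 0 1 0 1 0 0 0 1" and ?r = "lab 0 1 0 1 0 1 0 0"
  have fixed: "fixed_labeling ?f"
    by (auto simp: fixed_labeling_def e8_vertices_eq)
  have orbit_f: "orbit ?f = {?f}"
    by (rule orbit_fixed_labeling[OF fixed])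
  have cover: "orbit a = orbit ?z \<or> orbit a = orbit ?r \<or> orbit a = {?f}" if "a \<in> labelings" for a
    using orbit_rel_normal_form[OF that] orbit_eq orbit_f by blast
  have orbitD: "b \<in> labelings" "parity b = parity a" if "b \<in> orbit a" for a b
    using that orbit_rel_in_labelings parity_orbit_rel by (auto simp: orbit_def)
  have z: "parity a = 1" if "a \<in> orbit ?z" for a
    using orbitD(2)[OF that] by simp
  \<comment> \<open>\<open>?f\<close> and \<open>?r\<close> have equal parity, so the invariant
    cannot separate them; that \<open>?f\<close> is alone in its orbit does.\<close>
  have "?f \<notin> orbit ?r"
  proof
    assume "?f \<in> orbit ?r"
    then have "orbit ?r = {?f}"
      using orbit_eq[of ?r ?f] orbit_f by (simp add: orbit_def)
    with mem_orbit_self[of ?r] show False by simp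
  qed
  then have r: "parity a = 0" "a \<noteq> ?f" if "a \<in> orbit ?r" for a
    using orbitD(2)[OF that] that by auto
  have part: "a \<in> orbit ?z \<or> a \<in> orbit ?r \<or> a = ?f" if "a \<in> labelings" for a
    using cover[OF that] mem_orbit_self[OF that] by auto
  have "parity ?f = 0"
    by simp
  \<comment> \<open>The three orbits cover all labelings. Parity 1 excludes \<open>orbit ?r\<close>
    and \<open>?f\<close>, while parity 0 excludes \<open>orbit ?z\<close>, so the necessary
    conditions \<open>z\<close> and \<open>r\<close> are also sufficient.\<close>
  then have mem: "a \<in> orbit ?z \<longleftrightarrow> odd (num_components a)"
      "a \<in> orbit ?r \<longleftrightarrow> even (num_components a) \<and> a \<noteq> ?f" if "a \<in> labelings" for a
    using part[OF that] z[of a] r[of a] unfolding odd_num_components_iff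
    by (metis zero_neq_one, metis odd_num_components_iff zero_neq_one)
  have orbit_z: "orbit ?z = {a \<in> labelings. odd (num_components a)}"
    using mem(1) orbitD(1) by blast
  have orbit_r: "orbit ?r = {a \<in> labelings. even (num_components a)} - {?f}"
    using mem(2) orbitD(1) by blast
  have orbits: "orbits = {orbit ?z, {?f}, orbit ?r}"
  proof
    show "orbits \<subseteq> {orbit ?z, {?f}, orbit ?r}"
      using cover by (auto simp: orbits_def orbit_def quotient_def)
    have "orbit a \<in> orbits" if "a \<in> labelings" for a
      using that by (auto simp: orbits_def orbit_def intro: quotientI)
    from this[of ?z] this[of ?f] this[of ?r] show "{orbit ?z, {?f}, orbit ?r} \<subseteq> orbits"
      by (simp add: orbit_f)
  qed
  have "orbit ?z \<noteq> orbit ?r" "orbit ?z \<noteq> {?f}" "orbit ?r \<noteq> {?f}"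
    using mem_orbit_self[of ?z] mem_orbit_self[of ?r] r(1)[of ?z] by force+
  then have "card orbits = 3"
    unfolding orbits by simp
  then show ?thesis
    unfolding labeling_of_eq_lab using orbits orbit_z orbit_r fixed by blast
qed

end
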